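(* Let $G$ be a simple graph and $A\in\mathcal{S}(G)$ with distinct eigenvalues $\Lambda=\{\lambda_1,\ldots,\lambda_q\}$, $\lambda_1<\cdots<\lambda_q$, and corresponding multiplicities $m_1,\ldots,m_q$. Then for every $S\subseteq\Lambda$, with $r=e_\Lambda(S)$, \[\sum_{\lambda_i\in S}m_i \leq Z_+^{(r)}(G).\]
   Context: For a simple graph $G$ on vertex set $\{1,\ldots,n\}$, $\mathcal{S}(G)$ is the set of real symmetric $n\times n$ matrices $A=(a_{ij})$ such that for $i\neq j$, $a_{ij}\neq 0$ iff $ij\in E(G)$; diagonal arbitrary. Evenly consecutive order: for $\Lambda=\{\lambda_1<\cdots<\lambda_q\}$ and $S\subseteq\Lambda$, partition $S$ into maximal consecutive segments $s_1,s_2,\ldots$, each of the form $\{\lambda_a,\lambda_{a+1},\ldots,\lambda_b\}$. A segment is boundary if it contains $\lambda_1$ or $\lambda_q$. Set $e_\Lambda(s)=|s|$ if $s$ is boundary, and $e_\Lambda(s)=2\lceil |s|/2\rceil$ otherwise; $e_\Lambda(S)=\sum_i e_\Lambda(s_i)$. PSD zero forcing on a simple graph $H$: given the current blue set $B$, let $W_1,\ldots,W_k$ be the vertex sets of the connected components of $H-B$; a blue vertex $u$ may force a white vertex $w\in W_i$ to become blue if $w$ is the only white neighbor of $u$ in $H[B\cup W_i]$. $Z_+(H)$ is the minimum size of an initial blue set that eventually makes all vertices blue. A lazy walk of length $r$ is a sequence $u_0,\ldots,u_r$ with $u_{t+1}=u_t$ or $u_tu_{t+1}\in E(G)$. $\Gamma(G,r)$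 is the multigraph on $V(G)$ with the number of edges between distinct $i,j$ equal to the number of lazy walks from $i$ to $j$ of length at most $r$. An edge configuration of a multigraph $\Gamma$ is a simple graph $H$ on its vertex set such that a pair joined by exactly one edge in $\Gamma$ is an edge of $H$, a pair joined by no edge is not, and a pair joined by two or more edges may or may not be. $Z_+^{(r)}(G)=\max Z_+(H)$ over all edge configurations $H$ of $\Gamma(G,r)$. *)

theory Defs
  imports
    "Jordan_Normal_Form.Spectral_Radius"
    "Graph_Theory.Digraph_Component"
begin

text \<open>
  A simple graph is a \<open>pair_graph\<close>: a finite, loop-free digraph with symmetric arc relation, the
  edge \<open>ij\<close> being represented by the two arcs \<open>(i, j)\<close> and \<open>(j, i)\<close>. To agree with the indexing of
  matrices, the vertices \<open>1, \<dots>, n\<close> are renamed to \<open>0, \<dots>, n - 1\<close>.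
\<close>

definition sym_matrices :: "nat \<Rightarrow> nat pair_pre_digraph \<Rightarrow> real mat set" where
  "sym_matrices n G = {A \<in> carrier_mat n n. transpose_mat A = A \<and>
     (\<forall>i<n. \<forall>j<n. i \<noteq> j \<longrightarrow> (A $$ (i, j) \<noteq> 0 \<longleftrightarrow> (i, j) \<in> parcs G))}"


section \<open>Evenly consecutive order\<close>

definition consecutive :: "real set \<Rightarrow> real set \<Rightarrow> bool" where
  "consecutive L s \<longleftrightarrow> (\<exists>a\<in>L. \<exists>b\<in>L. a \<le> b \<and> s = {x \<in> L. a \<le> x \<and> x \<le> b})"

definition segments :: "real set \<Rightarrow> real set \<Rightarrow> real set set" where
  "segments L S = {s. consecutive L s \<and> s \<subseteq> S \<and>
     (\<forall>t. consecutive L t \<and> t \<subseteq> S \<and> s \<subseteq> t \<longrightarrow> t = s)}"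

definition boundary_segment :: "real set \<Rightarrow> real set \<Rightarrow> bool" where
  "boundary_segment L s \<longleftrightarrow> Min L \<in> s \<or> Max L \<in> s"

definition segment_order :: "real set \<Rightarrow> real set \<Rightarrow> nat" where
  "segment_order L s =
     (if boundary_segment L s then card s else 2 * nat \<lceil>real (card s) / 2\<rceil>)"

definition even_consec_order :: "real set \<Rightarrow> real set \<Rightarrow> nat" where
  "even_consec_order L S = (\<Sum>s\<in>segments L S. segment_order L s)"


section \<open>PSD zero forcing\<close>

text \<open>
  On a symmetric digraph the strongly connected components are the connected components of the
  underlying undirected graph.
\<close>

definition white_components :: "'a pair_pre_digraph \<Rightarrow> 'a set \<Rightarrow> 'a set set" where
  "white_components H B = pre_digraph.sccs_verts (with_proj H \<restriction> (pverts H - B))"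

definition psd_force :: "'a pair_pre_digraph \<Rightarrow> 'a set \<Rightarrow> 'a \<Rightarrow> 'a \<Rightarrow> bool" where
  "psd_force H B u w \<longleftrightarrow> u \<in> B \<and>
     (\<exists>W\<in>white_components H B. w \<in> W \<and>
        {x. x \<notin> B \<and> (u, x) \<in> arcs (with_proj H \<restriction> (B \<union> W))} = {w})"

definition psd_step :: "'a pair_pre_digraph \<Rightarrow> 'a set \<Rightarrow> 'a set \<Rightarrow> bool" where
  "psd_step H B B' \<longleftrightarrow> (\<exists>u w. psd_force H B u w \<and> B' = insert w B)"

definition psd_forcing_set :: "'a pair_pre_digraph \<Rightarrow> 'a set \<Rightarrow> bool" where
  "psd_forcing_set H B \<longleftrightarrow> B \<subseteq> pverts H \<and> (psd_step H)\<^sup>*\<^sup>* B (pverts H)"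

definition Z_plus :: "'a pair_pre_digraph \<Rightarrow> nat" where
  "Z_plus H = Min (card ` {B. psd_forcing_set H B})"


section \<open>Lazy walks and edge configurations\<close>

definition lazy_walks :: "'a pair_pre_digraph \<Rightarrow> nat \<Rightarrow> 'a \<Rightarrow> 'a \<Rightarrow> 'a list set" where
  "lazy_walks G k i j = {us. length us = Suc k \<and> set us \<subseteq> pverts G \<and> us ! 0 = i \<and> us ! k = j \<and>
     (\<forall>t<k. us ! Suc t = us ! t \<or> (us ! t, us ! Suc t) \<in> parcs G)}"

text \<open>
  A loopless undirected multigraph is given by its vertex set and the number of edges joining
  each pair of vertices.
\<close>

record 'a multigraph =
  mg_verts :: "'a set"
  mg_edges :: "'a \<Rightarrow> 'a \<Rightarrow> nat"

definition lazy_walk_multigraph :: "'a pair_pre_digraph \<Rightarrow> nat \<Rightarrow> 'a multigraph" where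
  "lazy_walk_multigraph G r =
     \<lparr> mg_verts = pverts G,
       mg_edges = (\<lambda>i j. if i = j then 0 else card (\<Union>k\<le>r. lazy_walks G k i j)) \<rparr>"

definition edge_configuration :: "'a multigraph \<Rightarrow> 'a pair_pre_digraph \<Rightarrow> bool" where
  "edge_configuration M H \<longleftrightarrow> pair_graph H \<and> pverts H = mg_verts M \<and>
     (\<forall>i\<in>mg_verts M. \<forall>j\<in>mg_verts M. i \<noteq> j \<longrightarrow>
        (mg_edges M i j = 1 \<longrightarrow> (i, j) \<in> parcs H) \<and>
        (mg_edges M i j = 0 \<longrightarrow> (i, j) \<notin> parcs H))"

definition Z_plus_r :: "nat \<Rightarrow> 'a pair_pre_digraph \<Rightarrow> nat" where
  "Z_plus_r r G = Max {Z_plus H | H. edge_configuration (lazy_walk_multigraph G r) H}"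

end

theory Submission
  imports Defs "Jordan_Normal_Form.Jordan_Normal_Form_Uniqueness"
begin

text \<open>
  There is a real polynomial \<open>p\<close> of degree exactly \<open>r = e\<^sub>\<Lambda>(S)\<close>, a product of linear factors, that
  vanishes on \<open>S\<close> and is nonnegative on the spectrum: a boundary segment contributes its own linear
  factors up to sign, an inner segment needs an even number of them. An entry \<open>(i, j)\<close> of
  \<open>M = p(A)\<close> is a sum over the lazy walks of length \<open>r\<close> from \<open>i\<close> to \<open>j\<close>. If only one lazy walk of
  length at most \<open>r\<close> exists, it has length \<open>r\<close> and no lazy steps, so the entry is nonzero; hence the
  graph \<open>H\<close> of \<open>M\<close> is an edge configuration. Since \<open>M\<close> is positive semidefinite (it is the square of
  the symmetric matrix \<open>sqrt p(A)\<close>), a vector of its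
  kernel that vanishes on a blue set also vanishes at each newly forced vertex, so a PSD forcing set
  has at least \<open>dim ker M\<close> elements, and \<open>ker M\<close> contains the eigenspaces for \<open>S\<close>.
\<close>

section \<open>The polynomial of a set of eigenvalues\<close>

lemma prod_list_diff_pos:
  fixes x :: "'a :: linordered_idom"
  assumes "\<forall>c\<in>set cs. c < x"
  shows "0 < (\<Prod>c\<leftarrow>cs. x - c)"
  using assms by (induction cs) auto

lemma prod_list_diff_sign:
  fixes x :: "'a :: linordered_idom"
  assumes "\<forall>c\<in>set cs. x < c"
  shows "0 < (- 1) ^ length cs * (\<Prod>c\<leftarrow>cs. x - c)"
  using assms
proof (induction cs)
  case (Cons a cs)
  have "0 < (a - x) * ((- 1) ^ length cs * (\<Prod>c\<leftarrow>cs. x - c))"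
    by (rule mult_pos_pos) (use Cons in auto)
  then show ?case by (simp add: algebra_simps)
qed simp

lemma finite_segments: "finite L \<Longrightarrow> finite (segments L S)"
  by (rule finite_subset[of _ "Pow L"]) (auto simp: segments_def consecutive_def)

text \<open>For \<open>x\<close> in \<open>S\<close> the singleton \<open>{x}\<close> is
  consecutive, and \<open>finite L\<close> lets it grow to a maximal consecutive subset of
  \<open>S\<close>.\<close>

lemma Union_segments:
  assumes "finite L" and "S \<subseteq> L"
  shows "S \<subseteq> \<Union> (segments L S)"
proof
  fix x assume x: "x \<in> S"
  let ?T = "{t. consecutive L t \<and> t \<subseteq> S}"
  have "{x} \<in> ?T"
    using x assms unfolding consecutive_def by (auto intro!: bexI[of _ x])
  moreover have "finite ?T"
    by (rule finite_subset[of _ "Pow L"]) (use assms in \<open>auto simp: consecutive_def\<close>)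
  ultimately obtain s where "s \<in> ?T" "{x} \<subseteq> s" "\<forall>t\<in>?T. s \<subseteq> t \<longrightarrow> s = t"
    using finite_has_maximal2[of ?T "{x}"] by blast
  then have "s \<in> segments L S" "x \<in> s"
    unfolding segments_def by blast+
  then show "x \<in> \<Union> (segments L S)" by blast
qed

text \<open>An element of \<open>L\<close> outside \<open>s\<close> lies entirely above or entirely
  below \<open>s\<close>, so all its factors have the same sign. If \<open>s\<close> contains
  \<open>Min L\<close>, only "above" occurs; if it contains \<open>Max L\<close>, only "below"
  occurs and \<open>(- 1) ^ length\<close> corrects the sign; otherwise the number of factors must
  be even.\<close>

lemma segment_polynomial:
  assumes L: "finite L" and s: "consecutive L s"
  obtains \<sigma> :: real and cs where
    "\<sigma> \<noteq> 0" "length cs = segment_order L s" "s \<subseteq> set cs"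
    "\<And>x. x \<in> L \<Longrightarrow> 0 \<le> \<sigma> * (\<Prod>c\<leftarrow>cs. x - c)"
proof -
  obtain a b where ab: "a \<in> L" "b \<in> L" "a \<le> b" "s = {x \<in> L. a \<le> x \<and> x \<le> b}"
    using s unfolding consecutive_def by blast
  have fin: "finite s" using L ab by auto
  let ?l = "sorted_list_of_set s"
  have zero: "(\<Prod>c\<leftarrow>cs. x - c) = 0" if "x \<in> set cs" for x :: real and cs
    using that by (auto simp: prod_list_zero_iff)
  consider (low) "Min L \<in> s" | (high) "Max L \<in> s" "Min L \<notin> s"
    | (inner) "Min L \<notin> s" "Max L \<notin> s" by blast
  then show thesis
  proof cases
    case low
    have "0 \<le> 1 * (\<Prod>c\<leftarrow>?l. x - c)" if x: "x \<in> L" for x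
    proof (cases "x \<in> s")
      case False
      have "a \<le> Min L" using low ab(4) by simp
      also have "Min L \<le> x" using L x by simp
      finally have "a \<le> x" .
      then have "\<forall>c\<in>set ?l. c < x" using False x ab fin by auto
      then show ?thesis using prod_list_diff_pos[of ?l x] by simp
    qed (use fin in \<open>simp add: zero\<close>)
    moreover have "length ?l = segment_order L s"
      using low fin by (simp add: segment_order_def boundary_segment_def)
    ultimately show thesis
      using that[of 1 ?l] fin by simp
  next
    case high
    have "0 \<le> (- 1) ^ length ?l * (\<Prod>c\<leftarrow>?l. x - c)" if x: "x \<in> L" for x
    proof (cases "x \<in> s")
      case False
      have "x \<le> Max L" using L x by simp
      also have "Max L \<le> b" using high ab(4) by simp
      finally have "x \<le> b" .
      then have "\<forall>c\<in>set ?l. x < c" using False x ab fin by auto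
      then show ?thesis using prod_list_diff_sign[of ?l x] by simp
    qed (use fin in \<open>simp add: zero\<close>)
    moreover have "length ?l = segment_order L s"
      using high fin by (simp add: segment_order_def boundary_segment_def)
    ultimately show thesis
      using that[of "(- 1) ^ length ?l" ?l] fin by simp
  next
    case inner
    \<comment> \<open>A repeated root makes the degree even without changing the zero set.\<close>
    define cs where "cs = (if even (card s) then ?l else a # ?l)"
    have a: "a \<in> s" using ab by auto
    have set: "set cs = s" using a fin by (auto simp: cs_def)
    have even: "even (length cs)" using fin by (simp add: cs_def)
    have len: "length cs = segment_order L s"
    proof (cases "even (card s)")
      case True
      then show ?thesis using inner fin
        by (auto simp: cs_def segment_order_def boundary_segment_def elim!: evenE)
    next
      case False
      then obtain k where k: "card s = 2 * k + 1" by (auto elim: oddE)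
      have "\<lceil>real (card s) / 2\<rceil> = int k + 1"
        unfolding k by (rule ceiling_unique) auto
      then show ?thesis using inner fin k
        by (simp add: cs_def segment_order_def boundary_segment_def)
    qed
    have "0 \<le> 1 * (\<Prod>c\<leftarrow>cs. x - c)" if x: "x \<in> L" for x
    proof (cases "x \<in> s")
      case False
      then have "(\<forall>c\<in>set cs. c < x) \<or> (\<forall>c\<in>set cs. x < c)"
        unfolding set using ab x by auto
      then show ?thesis
        using prod_list_diff_pos[of cs x] prod_list_diff_sign[of cs x] even by auto
    qed (use set in \<open>simp add: zero\<close>)
    then show thesis
      using that[of 1 cs] len set by simp
  qed
qed

lemma even_consec_order_polynomial:
  assumes L: "finite L" and S: "S \<subseteq> L"
  obtains \<sigma> :: real and cs where
    "\<sigma> \<noteq> 0" "length cs = even_consec_order L S" "S \<subseteq> set cs"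
    "\<And>x. x \<in> L \<Longrightarrow> 0 \<le> \<sigma> * (\<Prod>c\<leftarrow>cs. x - c)"
proof -
  \<comment> \<open>Multiplying polynomials appends their root lists, so degrees add and signs stay
    nonnegative. The claim is stated for arbitrary finite families \<open>T\<close>, because
    \<open>segments L S\<close> itself offers no induction.\<close>
  have "\<exists>\<sigma> cs. \<sigma> \<noteq> 0 \<and> length cs = (\<Sum>s\<in>T. segment_order L s) \<and> \<Union>T \<subseteq> set cs \<and>
      (\<forall>x\<in>L. 0 \<le> \<sigma> * (\<Prod>c\<leftarrow>cs. x - c))"
    if "finite T" "\<forall>s\<in>T. consecutive L s" for T
    using that
  proof (induction T rule: finite_induct)
    case empty
    show ?case by (intro exI[of _ "1::real"] exI[of _ "[]"]) simp
  next
    case (insert s T)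
    then obtain \<sigma> cs where 1: "\<sigma> \<noteq> 0" "length cs = (\<Sum>s\<in>T. segment_order L s)"
      "\<Union>T \<subseteq> set cs" "\<And>x. x \<in> L \<Longrightarrow> 0 \<le> \<sigma> * (\<Prod>c\<leftarrow>cs. x - c)" by auto
    obtain \<tau> ds where 2: "\<tau> \<noteq> 0" "length ds = segment_order L s" "s \<subseteq> set ds"
      "\<And>x. x \<in> L \<Longrightarrow> 0 \<le> \<tau> * (\<Prod>c\<leftarrow>ds. x - c)"
      using segment_polynomial[OF L, of s] insert.prems by blast
    have "0 \<le> (\<tau> * \<sigma>) * (\<Prod>c\<leftarrow>ds @ cs. x - c)" if "x \<in> L" for x
      using mult_nonneg_nonneg[OF 2(4)[OF that] 1(4)[OF that]] by (simp add: mult_ac)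
    moreover have "\<tau> * \<sigma> \<noteq> 0" using 1(1) 2(1) by simp
    moreover have "length (ds @ cs) = (\<Sum>s\<in>insert s T. segment_order L s)"
      using 1(2) 2(2) insert.hyps by simp
    moreover have "\<Union> (insert s T) \<subseteq> set (ds @ cs)" using 1(3) 2(3) by auto
    ultimately show ?case by blast
  qed
  moreover have "\<forall>s\<in>segments L S. consecutive L s" by (simp add: segments_def)
  ultimately obtain \<sigma> cs where
    "\<sigma> \<noteq> 0" "length cs = even_consec_order L S" "\<Union> (segments L S) \<subseteq> set cs"
    "\<forall>x\<in>L. 0 \<le> \<sigma> * (\<Prod>c\<leftarrow>cs. x - c)"
    using finite_segments[OF L] unfolding even_consec_order_def by meson
  then show thesis
    using that[of \<sigma> cs] Union_segments[OF L S] by blast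
qed


section \<open>Symmetric matrices\<close>

text \<open>Over the complex numbers the polynomial splits. For a root \<open>c\<close> with
  eigenvector \<open>v\<close>, moving the real symmetric matrix across the Hermitian product gives
  \<open>c * (v \<bullet>c v) = cnj c * (v \<bullet>c v)\<close>, so \<open>c\<close> is
  real.\<close>

lemma real_symmetric_char_poly_splits:
  fixes A :: "real mat"
  assumes A: "A \<in> carrier_mat n n" and sym: "transpose_mat A = A"
  shows "\<exists>as. char_poly A = (\<Prod>a\<leftarrow>as. [:- a, 1:])"
proof -
  define B where "B = map_mat complex_of_real A"
  have B: "B \<in> carrier_mat n n" using A by (simp add: B_def)
  have symB: "transpose_mat B = B"
    unfolding B_def by (metis sym map_mat_transpose)
  have cB: "char_poly B = map_poly complex_of_real (char_poly A)"
    unfolding B_def by (rule of_real_hom.char_poly_hom[OF A])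
  obtain cs where cs: "char_poly B = (\<Prod>c\<leftarrow>cs. [:- c, 1:])"
    using char_poly_factorized[OF B] by blast
  have real: "c = complex_of_real (Re c)" if c: "c \<in> set cs" for c
  proof -
    have "poly (char_poly B) c = 0" unfolding cs using c by (auto simp: poly_prod_list prod_list_zero_iff)
    then have "eigenvalue B c" using eigenvalue_root_char_poly[OF B] by simp
    then obtain v where v: "v \<in> carrier_vec n" "v \<noteq> 0\<^sub>v n" "B *\<^sub>v v = c \<cdot>\<^sub>v v"
      using B unfolding eigenvalue_def eigenvector_def by auto
    have conj: "B *\<^sub>v conjugate v = conjugate (B *\<^sub>v v)"
    proof (rule eq_vecI)
      fix i assume "i < dim_vec (conjugate (B *\<^sub>v v))"
      then have i: "i < n" using B by simp
      have r: "cnj (B $$ (i, j)) = B $$ (i, j)" if "j < n" for j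
        using that i A by (simp add: B_def)
      show "(B *\<^sub>v conjugate v) $ i = conjugate (B *\<^sub>v v) $ i"
        using i B v(1) r by (simp add: scalar_prod_def)
    qed (use B in simp)
    have "c * (v \<bullet>c v) = (B *\<^sub>v v) \<bullet>c v" using v by simp
    also have "\<dots> = (transpose_mat B *\<^sub>v v) \<bullet> conjugate v" unfolding symB ..
    also have "\<dots> = v \<bullet> (B *\<^sub>v conjugate v)"
      by (rule transpose_vec_mult_scalar[OF B]) (use v in auto)
    also have "\<dots> = v \<bullet> conjugate (c \<cdot>\<^sub>v v)" unfolding conj v(3) ..
    also have "\<dots> = cnj c * (v \<bullet>c v)" using v(1) by (simp add: conjugate_smult_vec)
    finally have "c = cnj c" using v(1,2) by simp
    then show ?thesis by (metis complex_cnj_cancel_iff Reals_cnj_iff of_real_Re)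
  qed
  \<comment> \<open>The embedding of real into complex polynomials is injective, which brings the
    factorization back to the reals.\<close>
  interpret h: map_poly_inj_comm_ring_hom complex_of_real ..
  have "map_poly complex_of_real (\<Prod>a\<leftarrow>map Re cs. [:- a, 1:]) = (\<Prod>c\<leftarrow>cs. [:- c, 1:])"
    using real
  proof (induction cs)
    case (Cons c cs)
    have "map_poly complex_of_real [:- Re c, 1:] = [:- c, 1:]"
      using Cons.prems[of c] by simp
    moreover have "map_poly complex_of_real (\<Prod>a\<leftarrow>map Re cs. [:- a, 1:]) = (\<Prod>c\<leftarrow>cs. [:- c, 1:])"
      using Cons by simp
    ultimately show ?case unfolding list.map prod_list.Cons h.hom_mult by simp
  qed simp
  then have "map_poly complex_of_real (char_poly A) = map_poly complex_of_real (\<Prod>a\<leftarrow>map Re cs. [:- a, 1:])"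
    using cs cB by simp
  then have "char_poly A = (\<Prod>a\<leftarrow>map Re cs. [:- a, 1:])"
    by (rule h.injectivity)
  then show ?thesis by blast
qed

text \<open>The quadratic form of \<open>N * N\<close> at \<open>v\<close> is the squared norm of
  \<open>N v\<close>. This serves twice: to exclude larger Jordan blocks, and as the positive
  semidefiniteness behind PSD forcing.\<close>

lemma symmetric_mult_kernel:
  fixes N :: "real mat"
  assumes N: "N \<in> carrier_mat n n" and sym: "transpose_mat N = N"
    and v: "v \<in> carrier_vec n" and 0: "v \<bullet> ((N * N) *\<^sub>v v) = 0"
  shows "N *\<^sub>v v = 0\<^sub>v n"
proof -
  have "(N *\<^sub>v v) \<bullet>c (N *\<^sub>v v) = (transpose_mat N *\<^sub>v v) \<bullet> (N *\<^sub>v v)" using sym by simp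
  also have "\<dots> = v \<bullet> (N *\<^sub>v (N *\<^sub>v v))"
    by (rule transpose_vec_mult_scalar[OF N]) (use N v in auto)
  also have "\<dots> = 0" using 0 N v by simp
  finally show ?thesis
    using conjugate_square_eq_0_vec[of "N *\<^sub>v v" n] N v by simp
qed

lemma char_matrix_transpose:
  assumes "A \<in> carrier_mat n n" "transpose_mat A = A"
  shows "transpose_mat (char_matrix A e) = char_matrix A e"
proof (rule eq_matI)
  fix i j assume "i < dim_row (char_matrix A e)" "j < dim_col (char_matrix A e)"
  then have ij: "i < n" "j < n" using assms by (auto simp: char_matrix_def)
  have "A $$ (j, i) = A $$ (i, j)" using assms ij by (metis carrier_matD index_transpose_mat(1))
  then show "transpose_mat (char_matrix A e) $$ (i, j) = char_matrix A e $$ (i, j)"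
    using ij assms(1) by (auto simp: char_matrix_def)
qed (use assms in \<open>auto simp: char_matrix_def\<close>)

text \<open>This is diagonalizability. It does not provide an orthogonal change of basis;
  \<open>spectral_function_symmetric\<close> makes up for that.\<close>

lemma real_symmetric_jordan_nf:
  fixes A :: "real mat"
  assumes A: "A \<in> carrier_mat n n" and sym: "transpose_mat A = A"
  obtains ds where "jordan_nf A (map (Pair 1) ds)"
proof -
  obtain n_as where jnf: "jordan_nf A n_as"
    using real_symmetric_char_poly_splits[OF A sym] jordan_nf_exists[OF A] by blast
  have "fst na = 1" if na: "na \<in> set n_as" for na
  proof -
    obtain k e where ke: "na = (k, e)" by force
    let ?C = "char_matrix A e"
    have C: "?C \<in> carrier_mat n n" using A by simp
    \<comment> \<open>No generalized eigenvectors of rank two, so all Jordan blocks have size one.\<close>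
    have ker: "mat_kernel (?C * ?C) = mat_kernel ?C"
    proof (rule subset_antisym)
      show "mat_kernel (?C * ?C) \<subseteq> mat_kernel ?C"
      proof
        fix v assume "v \<in> mat_kernel (?C * ?C)"
        from mat_kernelD[OF _ this, of n n] have v: "v \<in> carrier_vec n" "(?C * ?C) *\<^sub>v v = 0\<^sub>v n"
          using C by auto
        then have "?C *\<^sub>v v = 0\<^sub>v n"
          using symmetric_mult_kernel[OF C char_matrix_transpose[OF A sym] v(1)] by simp
        then show "v \<in> mat_kernel ?C" using mat_kernelI[OF C v(1)] by blast
      qed
    qed (rule mat_kernel_mult_subset[OF C C])
    have "dim_gen_eigenspace A e 2 = dim_gen_eigenspace A e 1"
      using C ker by (simp add: dim_gen_eigenspace_def kernel_dim_def numeral_2_eq_2)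
    then have eq: "(\<Sum>n\<leftarrow>map fst [(n, a)\<leftarrow>n_as. a = e]. min 2 n)
        = (\<Sum>n\<leftarrow>map fst [(n, a)\<leftarrow>n_as. a = e]. min 1 n)"
      unfolding dim_gen_eigenspace[OF jnf] .
    \<comment> \<open>A block of size \<open>k\<close> contributes \<open>min m k\<close> to the
      generalized eigenspace of rank \<open>m\<close>. The terms for rank 1 never exceed those for
      rank 2, so equal sums force equal terms, that is, \<open>k \<le> 1\<close>.\<close>
    have strict: "min 2 k = min 1 k" if "(\<Sum>n\<leftarrow>ns. min 2 n) = (\<Sum>n\<leftarrow>ns. min 1 n)" "k \<in> set ns"
      for ns and k :: nat
      using that
    proof (induction ns)
      case (Cons m ns)
      have "(\<Sum>n\<leftarrow>ns. min 1 n) \<le> (\<Sum>n\<leftarrow>ns. min 2 n)" by (rule sum_list_mono) auto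
      then have "min 2 m = min 1 m" "(\<Sum>n\<leftarrow>ns. min 2 n) = (\<Sum>n\<leftarrow>ns. min 1 n)"
        using Cons.prems(1) by auto
      then show ?case using Cons by auto
    qed simp
    have "k \<in> set (map fst [(n, a)\<leftarrow>n_as. a = e])" using na ke by force
    then have "min 2 k = min 1 k" using strict[OF eq] by blast
    moreover have "k \<noteq> 0" using jnf na ke unfolding jordan_nf_def by force
    ultimately show ?thesis using ke by (auto simp: min_def split: if_splits)
  qed
  then have "map (Pair 1) (map snd n_as) = n_as"
    by (intro nth_equalityI) (auto simp: prod_eq_iff)
  then show thesis using that jnf by metis
qed

lemma jordan_matrix_Pair_1: "jordan_matrix (map (Pair 1) ds) = mat_diag (length ds) (\<lambda>i. ds ! i)"
proof (induction ds)
  case Nil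
  then show ?case by (intro eq_matI) (auto simp: jordan_matrix_def mat_diag_def)
next
  case (Cons a ds)
  have "jordan_matrix (map (Pair 1) (a # ds)) =
     four_block_mat (jordan_block 1 a) (0\<^sub>m 1 (length ds)) (0\<^sub>m (length ds) 1)
       (jordan_matrix (map (Pair 1) ds))"
    using jordan_matrix_dim[of "map (Pair 1) ds"]
    by (simp add: jordan_matrix_def Let_def o_def sum_list_triv)
  also have "\<dots> = mat_diag (length (a # ds)) (\<lambda>i. (a # ds) ! i)"
    unfolding Cons.IH by (intro eq_matI) (auto simp: mat_diag_def jordan_block_def nth_Cons')
  finally show ?case .
qed

text \<open>The columns of \<open>P\<close> form an eigenbasis with eigenvalues \<open>d i\<close>.
  The second conclusion turns multiplicities into cardinalities of sets of column indices.\<close>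

lemma real_symmetric_diagonalization:
  fixes A :: "real mat"
  assumes A: "A \<in> carrier_mat n n" and sym: "transpose_mat A = A"
  obtains d P Q where "similar_mat_wit A (mat_diag n d) P Q"
    "\<And>\<mu>. Polynomial.order \<mu> (char_poly A) = card {i. i < n \<and> d i = \<mu>}"
proof -
  obtain ds where jnf: "jordan_nf A (map (Pair 1) ds)"
    using real_symmetric_jordan_nf[OF A sym] by blast
  then obtain P Q where w: "similar_mat_wit A (mat_diag (length ds) (\<lambda>i. ds ! i)) P Q"
    unfolding jordan_nf_def jordan_matrix_Pair_1 similar_mat_def by blast
  have len: "length ds = n"
    using carrier_matD(1)[OF similar_mat_witD2(5)[OF A w]] by (simp add: mat_diag_def)
  have "Polynomial.order \<mu> (char_poly A) = card {i. i < n \<and> ds ! i = \<mu>}" for \<mu>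
  proof -
    have "sum_list (map fst (filter (\<lambda>na. snd na = \<mu>) (map (Pair (1::nat)) es)))
        = length (filter (\<lambda>a. a = \<mu>) es)" for es
      by (induction es) auto
    then show ?thesis
      unfolding jordan_nf_order[OF jnf] by (simp add: length_filter_conv_card len)
  qed
  then show thesis using that w len by metis
qed

section \<open>Functions of a diagonalized symmetric matrix\<close>

lemma mult_mat_zero_vec:
  "A \<in> carrier_mat n m \<Longrightarrow> A *\<^sub>v 0\<^sub>v m = 0\<^sub>v n"
  by (intro eq_vecI) auto

lemma similar_mult:
  fixes P :: "'a :: comm_ring_1 mat"
  assumes "P \<in> carrier_mat n n" "Q \<in> carrier_mat n n" "D \<in> carrier_mat n n" "E \<in> carrier_mat n n"
    and QP: "Q * P = 1\<^sub>m n"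
  shows "(P * D * Q) * (P * E * Q) = P * (D * E) * Q"
proof -
  have "(P * D * Q) * (P * E * Q) = P * (D * ((Q * P) * (E * Q)))"
    using assms(1-4) by (simp add: assoc_mult_mat[of _ n n _ n _ n] mult_carrier_mat[of _ n n _ n] del: QP)
  also have "\<dots> = P * (D * E) * Q"
    using assms(1-4) unfolding QP
    by (simp add: assoc_mult_mat[of _ n n _ n _ n] mult_carrier_mat[of _ n n _ n])
  finally show ?thesis .
qed

text \<open>The matrix in question is \<open>g(A)\<close>. As \<open>P\<close> need not be
  orthogonal, the Gram matrix of its columns takes the place of the identity. The later use has
  \<open>g = sqrt \<circ> p\<close>, so symmetry is proved for every function
  \<open>g\<close>.\<close>

lemma spectral_function_symmetric:
  fixes A :: "'a :: field mat"
  assumes A: "A \<in> carrier_mat n n" and sym: "transpose_mat A = A"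
    and w: "similar_mat_wit A (mat_diag n d) P Q"
  shows "transpose_mat (P * mat_diag n (\<lambda>i. g (d i)) * Q) = P * mat_diag n (\<lambda>i. g (d i)) * Q"
proof -
  note PQ = similar_mat_witD2[OF A w]
  let ?D = "mat_diag n d" and ?F = "mat_diag n (\<lambda>i. g (d i))"
  define X where "X = P * ?F * Q"
  \<comment> \<open>Symmetry of \<open>A\<close> says that \<open>K\<close> commutes with \<open>?D\<close>, hence also with every function of \<open>?D\<close>.\<close>
  define K where "K = transpose_mat P * P"
  have D: "mat_diag n h \<in> carrier_mat n n" for h :: "nat \<Rightarrow> 'a" by simp
  have Dt: "transpose_mat (mat_diag n h) = mat_diag n h" for h :: "nat \<Rightarrow> 'a"
    by (intro eq_matI) (auto simp: mat_diag_def)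
  have Pt: "transpose_mat P \<in> carrier_mat n n" and Qt: "transpose_mat Q \<in> carrier_mat n n"
    using PQ by auto
  have K: "K \<in> carrier_mat n n" using PQ Pt by (simp add: K_def)
  have X: "X \<in> carrier_mat n n"
    unfolding X_def by (rule mult_carrier_mat[OF mult_carrier_mat[OF PQ(6) D] PQ(7)])
  have Kt: "transpose_mat K = K"
    unfolding K_def by (subst transpose_mult[OF Pt PQ(6)]) simp
  have congr: "transpose_mat P * Y * P = K * mat_diag n h"
    if "Y = P * mat_diag n h * Q" for Y and h :: "nat \<Rightarrow> 'a"
  proof -
    have "transpose_mat P * Y * P = transpose_mat P * (P * (mat_diag n h * (Q * P)))"
      unfolding that using PQ(6,7) Pt D[of h]
      by (simp add: assoc_mult_mat[of _ n n _ n _ n] mult_carrier_mat[of _ n n _ n])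
    also have "\<dots> = K * mat_diag n h"
      unfolding PQ(2) K_def right_mult_one_mat[OF D] assoc_mult_mat[OF Pt PQ(6) D] ..
    finally show ?thesis .
  qed
  have congr_t: "transpose_mat (transpose_mat P * Y * P) = transpose_mat P * transpose_mat Y * P"
    if Y: "Y \<in> carrier_mat n n" for Y
  proof -
    have Yt: "transpose_mat Y \<in> carrier_mat n n" using Y by simp
    show ?thesis
      using transpose_mult[OF mult_carrier_mat[OF Pt Y] PQ(6)] transpose_mult[OF Pt Y]
        assoc_mult_mat[OF Pt Yt PQ(6)] by simp
  qed
  have KDt: "transpose_mat (K * mat_diag n h) = mat_diag n h * K" for h :: "nat \<Rightarrow> 'a"
    using transpose_mult[OF K D[of h]] Kt Dt by simp
  have comm: "K * ?D = ?D * K"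
    using congr[OF PQ(3)] congr_t[OF A] sym KDt by metis
  \<comment> \<open>Entrywise, \<open>K\<close> vanishes wherever \<open>d i\<close> and
    \<open>d j\<close> differ; elsewhere \<open>g (d i)\<close> and \<open>g (d j)\<close>
    agree.\<close>
  have entry: "K $$ (i, j) * d j = d i * K $$ (i, j)" if "i < n" "j < n" for i j
    using arg_cong[OF comm, of "\<lambda>Y. Y $$ (i, j)"] that
    unfolding mat_diag_mult_left[OF K] mat_diag_mult_right[OF K] by simp
  have "K * ?F = ?F * K"
    unfolding mat_diag_mult_left[OF K] mat_diag_mult_right[OF K]
  proof (intro eq_matI)
    fix i j assume "i < dim_row (mat n n (\<lambda>(i, j). g (d i) * K $$ (i, j)))"
      "j < dim_col (mat n n (\<lambda>(i, j). g (d i) * K $$ (i, j)))"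
    then have ij: "i < n" "j < n" by auto
    show "mat n n (\<lambda>(i, j). K $$ (i, j) * g (d j)) $$ (i, j)
        = mat n n (\<lambda>(i, j). g (d i) * K $$ (i, j)) $$ (i, j)"
      using entry[OF ij] ij by (cases "K $$ (i, j) = 0") auto
  qed auto
  then have eq: "transpose_mat P * transpose_mat X * P = transpose_mat P * X * P"
    using congr[OF X_def] congr_t[OF X] KDt by metis
  have cancel: "transpose_mat Q * (transpose_mat P * Y * P) * Q = Y"
    if Y: "Y \<in> carrier_mat n n" for Y
  proof -
    have QPt: "transpose_mat Q * transpose_mat P = 1\<^sub>m n"
      using transpose_mult[OF PQ(6,7)] PQ(1) by simp
    have "transpose_mat Q * (transpose_mat P * Y * P) * Q
        = (transpose_mat Q * transpose_mat P) * (Y * (P * Q))"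
      using PQ(6,7) Pt Qt Y
      by (simp add: assoc_mult_mat[of _ n n _ n _ n] mult_carrier_mat[of _ n n _ n])
    then show ?thesis unfolding QPt PQ(1) using Y by simp
  qed
  have "transpose_mat X = X"
    using cancel[OF X] cancel[of "transpose_mat X"] X eq by simp
  then show ?thesis unfolding X_def .
qed


section \<open>Lazy walks and products of shifts of the matrix\<close>

lemma lazy_walks_0: "lazy_walks G 0 i j = (if i = j \<and> i \<in> pverts G then {[i]} else {})"
  unfolding lazy_walks_def by (auto simp: length_Suc_conv)

lemma lazy_walks_Suc:
  "i # us \<in> lazy_walks G (Suc k) i j \<longleftrightarrow> i \<in> pverts G \<and>
     (\<exists>l. (l = i \<or> (i, l) \<in> parcs G) \<and> us \<in> lazy_walks G k l j)"
  unfolding lazy_walks_def by (auto simp: All_less_Suc2)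

lemma lazy_walks_SucE:
  assumes "w \<in> lazy_walks G (Suc k) i j"
  obtains l us where "w = i # us" "i \<in> pverts G" "l = i \<or> (i, l) \<in> parcs G" "us \<in> lazy_walks G k l j"
proof -
  have "w \<noteq> []" "w ! 0 = i" using assms unfolding lazy_walks_def by auto
  then obtain us where w: "w = i # us" by (cases w) auto
  then show thesis using that assms lazy_walks_Suc by metis
qed

lemma finite_lazy_walks:
  assumes "finite (pverts G)"
  shows "finite (lazy_walks G k i j)"
  by (rule finite_subset[OF _ finite_lists_length_eq[OF assms, of "Suc k"]])
    (auto simp: lazy_walks_def)

text \<open>The polynomial of \<open>A\<close> with root list \<open>cs\<close>, kept as a product
  so that peeling off one factor matches the first step of a lazy walk: an edge has weight
  \<open>A $$ (i, k)\<close>, staying at \<open>i\<close> has weight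
  \<open>A $$ (i, i) - c\<close>.\<close>

fun shift_prod :: "nat \<Rightarrow> 'a :: field mat \<Rightarrow> 'a list \<Rightarrow> 'a mat" where
  "shift_prod n A [] = 1\<^sub>m n"
| "shift_prod n A (c # cs) = char_matrix A c * shift_prod n A cs"

lemma shift_prod_carrier [simp]:
  "A \<in> carrier_mat n n \<Longrightarrow> shift_prod n A cs \<in> carrier_mat n n"
  by (induction cs) (auto intro!: mult_carrier_mat)

lemma shift_prod_Cons_index:
  assumes "A \<in> carrier_mat n n" "i < n" "j < n"
  shows "shift_prod n A (c # cs) $$ (i, j)
    = (\<Sum>k<n. (A $$ (i, k) - (if i = k then c else 0)) * shift_prod n A cs $$ (k, j))"
proof -
  have "shift_prod n A cs \<in> carrier_mat n n" using assms by simp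
  then show ?thesis
    using assms
    by (auto simp: scalar_prod_def lessThan_atLeast0 char_matrix_def simp del: shift_prod_carrier intro!: sum.cong)
qed

lemma shift_prod_diagonalized:
  assumes A: "A \<in> carrier_mat n n" and w: "similar_mat_wit A (mat_diag n d) P Q"
  shows "shift_prod n A cs = P * mat_diag n (\<lambda>i. \<Prod>c\<leftarrow>cs. d i - c) * Q"
proof (induction cs)
  note PQ = similar_mat_witD2[OF A w]
  case Nil
  then show ?case using PQ by simp
next
  note PQ = similar_mat_witD2[OF A w]
  case (Cons c cs)
  have "char_matrix (mat_diag n d) c = mat_diag n (\<lambda>i. d i - c)"
    by (intro eq_matI) (auto simp: char_matrix_def mat_diag_def)
  then have "char_matrix A c = P * mat_diag n (\<lambda>i. d i - c) * Q"
    using similar_mat_witD2(3)[OF char_matrix_closed[OF A] similar_mat_wit_char_matrix[OF w], of c] by simp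
  then show ?case
    using Cons similar_mult[OF PQ(6,7) mat_diag_dim mat_diag_dim PQ(2)] by simp
qed

context
  fixes n :: nat and G :: "nat pair_pre_digraph" and A :: "real mat"
  assumes verts: "pverts G = {0..<n}" and A: "A \<in> sym_matrices n G"
begin

text \<open>Each nonzero term in the expansion of the entry traces a lazy walk with one step per
  factor.\<close>

lemma shift_prod_no_lazy_walk:
  assumes "i < n" "j < n" "lazy_walks G (length cs) i j = {}"
  shows "shift_prod n A cs $$ (i, j) = 0"
  using assms
proof (induction cs arbitrary: i)
  case Nil
  then show ?case using verts by (auto simp: lazy_walks_0 split: if_splits)
next
  case (Cons c cs)
  have Ac: "A \<in> carrier_mat n n" using A by (simp add: sym_matrices_def)
  have zero: "(A $$ (i, k) - (if i = k then c else 0)) * shift_prod n A cs $$ (k, j) = 0"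
    if k: "k < n" for k
  proof (cases "k = i \<or> (i, k) \<in> parcs G")
    case True
    then have "lazy_walks G (length cs) k j = {}"
      using Cons.prems lazy_walks_Suc[of i _ G "length cs" j] verts by fastforce
    then show ?thesis using Cons.IH[OF k Cons.prems(2)] by simp
  next
    case False
    then show ?thesis using A k Cons.prems(1) by (auto simp: sym_matrices_def)
  qed
  show ?case
    unfolding shift_prod_Cons_index[OF Ac Cons.prems(1,2)]
    by (rule sum.neutral, rule ballI, rule zero) simp
qed

text \<open>The weight of a lazy step may be zero. Counting walks of all lengths up to the number of
  factors keeps lazy steps out of a unique walk, so the entry is a product of nonzero off-diagonal
  entries of \<open>A\<close>.\<close>

lemma shift_prod_unique_lazy_walk:
  assumes "i < n" "j < n" "(\<Union>k\<le>length cs. lazy_walks G k i j) = {w}"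
  shows "shift_prod n A cs $$ (i, j) \<noteq> 0"
  using assms
proof (induction cs arbitrary: i w)
  case Nil
  then show ?case using verts by (auto simp: lazy_walks_0 split: if_splits)
next
  case (Cons c cs)
  have Ac: "A \<in> carrier_mat n n" using A by (simp add: sym_matrices_def)
  have i: "i \<in> pverts G" using Cons.prems(1) verts by simp
  have eqw: "v = w" if "v \<in> lazy_walks G k i j" "k \<le> Suc (length cs)" for v k
    using Cons.prems(3) that by auto
  have step: "i # v = w" if "v \<in> lazy_walks G k l j" "l = i \<or> (i, l) \<in> parcs G" "k \<le> length cs" for v k l
  proof (rule eqw)
    show "i # v \<in> lazy_walks G (Suc k) i j" unfolding lazy_walks_Suc using that i by blast
  qed (use that in simp)
  obtain k where k: "k \<le> Suc (length cs)" "w \<in> lazy_walks G k i j"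
    using Cons.prems(3) by auto
  \<comment> \<open>A walk \<open>v\<close> from \<open>i\<close> with a step to spare yields a
    second walk \<open>i # v\<close>, which first waits at \<open>i\<close>.\<close>
  have no_lazy: "v \<notin> lazy_walks G m i j" if "m \<le> length cs" for v m
  proof
    assume v: "v \<in> lazy_walks G m i j"
    then have "i # v = w" using step that by blast
    moreover have "v = w" using eqw[OF v] that by simp
    ultimately show False by (metis not_Cons_self2)
  qed
  then have "k = Suc (length cs)" using k by (meson le_SucE)
  then obtain l us where l: "w = i # us" "l = i \<or> (i, l) \<in> parcs G" "us \<in> lazy_walks G (length cs) l j"
    using k lazy_walks_SucE by metis
  have li: "l \<noteq> i" using l(3) no_lazy by blast
  have ln: "l < n" using l(3) verts unfolding lazy_walks_def by (cases us) auto
  have l_if: "k = l" if "v \<in> lazy_walks G (length cs) k j" "k = i \<or> (i, k) \<in> parcs G" for v k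
  proof -
    have "v = us" using step[OF that] l(1) by simp
    then show ?thesis using that(1) l(3) unfolding lazy_walks_def by auto
  qed
  have "(\<Union>k\<le>length cs. lazy_walks G k l j) = {us}"
    using step l by blast
  then have nz: "shift_prod n A cs $$ (l, j) \<noteq> 0"
    using Cons.IH[OF ln Cons.prems(2)] by blast
  have zero: "(A $$ (i, k) - (if i = k then c else 0)) * shift_prod n A cs $$ (k, j) = 0"
    if k: "k < n" "k \<noteq> l" for k
  proof (cases "k = i \<or> (i, k) \<in> parcs G")
    case True
    then have "lazy_walks G (length cs) k j = {}" using l_if k(2) by blast
    then show ?thesis using shift_prod_no_lazy_walk[OF k(1) Cons.prems(2)] by simp
  next
    case False
    then show ?thesis using A k(1) Cons.prems(1) by (auto simp: sym_matrices_def)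
  qed
  have "shift_prod n A (c # cs) $$ (i, j)
      = (\<Sum>k\<in>{l}. (A $$ (i, k) - (if i = k then c else 0)) * shift_prod n A cs $$ (k, j))"
    unfolding shift_prod_Cons_index[OF Ac Cons.prems(1,2)]
    by (rule sum.mono_neutral_right, simp, use ln in simp, rule ballI, rule zero) auto
  moreover have "A $$ (i, l) \<noteq> 0" using A l(2) li ln Cons.prems(1) by (auto simp: sym_matrices_def)
  ultimately show ?case using nz li by auto
qed

end


section \<open>PSD forcing sets and kernels\<close>

text \<open>Gaussian elimination, one equation and one unknown at a time. The solution is zero
  outside \<open>I\<close> so that it can serve directly as a coordinate vector.\<close>

lemma underdetermined_system:
  fixes a :: "'b \<Rightarrow> 'i \<Rightarrow> 'k :: field"
  assumes "finite B" "finite I" "card B < card I"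
  shows "\<exists>c. (\<exists>i\<in>I. c i \<noteq> 0) \<and> (\<forall>i. i \<notin> I \<longrightarrow> c i = 0) \<and> (\<forall>b\<in>B. (\<Sum>i\<in>I. a b i * c i) = 0)"
  using assms
proof (induction B arbitrary: a I rule: finite_induct)
  case empty
  then obtain i where "i \<in> I" by fastforce
  then show ?case by (intro exI[of _ "\<lambda>j. if j = i then 1 else 0"]) auto
next
  case (insert b B)
  show ?case
  proof (cases "\<exists>k\<in>I. a b k \<noteq> 0")
    case False
    have "card B < card I" using insert.hyps insert.prems by simp
    from insert.IH[OF insert.prems(1) this, of a] show ?thesis using False by auto
  next
    case True
    then obtain k where k: "k \<in> I" "a b k \<noteq> 0" by blast
    define J where "J = I - {k}"
    have J: "finite J" "card B < card J" "k \<notin> J" "I = insert k J"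
      using insert k unfolding J_def by (auto simp: card_Diff_singleton)
    \<comment> \<open>Subtracting multiples of row \<open>b\<close> clears the pivot column
      \<open>k\<close> from the other rows.\<close>
    obtain c where c: "\<exists>i\<in>J. c i \<noteq> 0" "\<forall>i. i \<notin> J \<longrightarrow> c i = 0"
      "\<forall>b'\<in>B. (\<Sum>i\<in>J. (a b' i - a b' k * a b i / a b k) * c i) = 0"
      using insert.IH[OF J(1,2), of "\<lambda>b' i. a b' i - a b' k * a b i / a b k"] by blast
    \<comment> \<open>Back substitution: this value at \<open>k\<close> solves equation
      \<open>b\<close>.\<close>
    define c' where "c' = c(k := - (\<Sum>i\<in>J. a b i * c i) / a b k)"
    have eq: "(\<Sum>i\<in>I. a b' i * c' i)
        = (\<Sum>i\<in>J. a b' i * c i) - a b' k / a b k * (\<Sum>i\<in>J. a b i * c i)" for b'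
    proof -
      have "(\<Sum>i\<in>J. a b' i * c' i) = (\<Sum>i\<in>J. a b' i * c i)"
        using J(3) by (intro sum.cong) (auto simp: c'_def)
      then show ?thesis using J by (simp add: c'_def)
    qed
    have "(\<Sum>i\<in>I. a b' i * c' i) = 0" if b': "b' \<in> insert b B" for b'
    proof (cases "b' = b")
      case True
      then show ?thesis unfolding eq using k by simp
    next
      case False
      then have "(\<Sum>i\<in>J. (a b' i - a b' k * a b i / a b k) * c i) = 0" using c(3) b' by blast
      moreover have "(a b' i - a b' k * a b i / a b k) * c i
          = a b' i * c i - a b' k / a b k * (a b i * c i)" for i
        by (simp add: left_diff_distrib)
      ultimately show ?thesis
        unfolding eq by (simp add: sum_subtractf sum_distrib_left)
    qed
    moreover have "\<exists>i\<in>I. c' i \<noteq> 0" "\<forall>i. i \<notin> I \<longrightarrow> c' i = 0"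
      using c(1,2) J by (auto simp: c'_def)
    ultimately show ?thesis by (intro exI[of _ c']) simp
  qed
qed

section \<open>The graph of a symmetric matrix and its white components\<close>

definition support_graph :: "real mat \<Rightarrow> nat pair_pre_digraph" where
  "support_graph M = \<lparr> pverts = {0..<dim_row M},
     parcs = {(i, j). i < dim_row M \<and> j < dim_row M \<and> i \<noteq> j \<and> M $$ (i, j) \<noteq> 0} \<rparr>"

lemma pair_graph_support_graph:
  assumes M: "M \<in> carrier_mat n n" and sym: "transpose_mat M = M"
  shows "pair_graph (support_graph M)"
proof
  show "finite (parcs (support_graph M))"
    by (rule finite_subset[of _ "{0..<n} \<times> {0..<n}"]) (use M in \<open>auto simp: support_graph_def\<close>)
  have "M $$ (i, j) = M $$ (j, i)" if "i < n" "j < n" for i j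
    using that M sym by (metis carrier_matD index_transpose_mat(1))
  then show "symmetric (with_proj (support_graph M))"
    using M by (auto simp: symmetric_def sym_def support_graph_def)
qed (auto simp: support_graph_def)

lemma white_component_subset:
  assumes "W \<in> white_components H B"
  shows "W \<subseteq> pverts H - B"
proof
  fix x assume "x \<in> W"
  then have "x \<rightarrow>\<^sup>*\<^bsub>with_proj H \<restriction> (pverts H - B)\<^esub> x"
    using assms unfolding white_components_def pre_digraph.sccs_verts_def by blast
  then show "x \<in> pverts H - B"
    unfolding reachable_def by (auto dest: in_rtrancl_on_in_F)
qed

text \<open>For a support graph this makes the matrix block diagonal on the white vertices. Symmetry
  of the arcs gives reachability both ways, as strong components demand.\<close>

lemma white_component_closed:
  assumes H: "pair_graph H" and W: "W \<in> white_components H B"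
    and x: "x \<in> W" and y: "y \<in> pverts H - B" and xy: "(x, y) \<in> parcs H"
  shows "y \<in> W"
proof (rule ccontr)
  assume "y \<notin> W"
  interpret H: pair_graph H by (rule H)
  let ?K = "with_proj H \<restriction> (pverts H - B)"
  have yx: "(y, x) \<in> parcs H"
    using H.pair_sym_arcs xy by (auto simp: symmetric_def dest: symD)
  have x': "x \<in> pverts H - B" using white_component_subset[OF W] x by blast
  have "(x, y) \<in> arcs_ends ?K" "(y, x) \<in> arcs_ends ?K"
    using x' y xy yx by (force simp: arcs_ends_def arc_to_ends_def induce_subgraph_def)+
  then have "x \<rightarrow>\<^sup>*\<^bsub>?K\<^esub> y" "y \<rightarrow>\<^sup>*\<^bsub>?K\<^esub> x"
    using x' y unfolding reachable_def
    by (auto intro: rtrancl_on_into_rtrancl_on)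
  then show False
    using W x \<open>y \<notin> W\<close> unfolding white_components_def pre_digraph.sccs_verts_def by blast
qed

section \<open>Kernels of positive semidefinite matrices, given as squares of symmetric ones\<close>

context
  fixes n :: nat and M N :: "real mat"
  assumes N: "N \<in> carrier_mat n n" and sym: "transpose_mat N = N" and M: "M = N * N"
begin

lemma square_carrier: "M \<in> carrier_mat n n"
  using N unfolding M by simp

lemma square_symmetric: "transpose_mat M = M"
  unfolding M using transpose_mult[OF N N] sym by simp

text \<open>Row \<open>u\<close> of \<open>M v = 0\<close> may involve white neighbours of
  \<open>u\<close> in several components, whereas the rule inspects only one. Positive
  semidefiniteness allows \<open>v\<close> to be replaced by its part on that component.\<close>

lemma psd_force_kernel:
  assumes v: "v \<in> carrier_vec n" "M *\<^sub>v v = 0\<^sub>v n"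
    and B: "\<forall>b\<in>B. b < n \<longrightarrow> v $ b = 0"
    and force: "psd_force (support_graph M) B u w"
  shows "v $ w = 0"
proof -
  note Mc = square_carrier
  let ?H = "support_graph M"
  have H: "pair_graph ?H" by (rule pair_graph_support_graph[OF square_carrier square_symmetric])
  have verts: "pverts ?H = {0..<n}" using Mc by (simp add: support_graph_def)
  have arcs: "(i, j) \<in> parcs ?H \<longleftrightarrow> i < n \<and> j < n \<and> i \<noteq> j \<and> M $$ (i, j) \<noteq> 0" for i j
    using Mc by (simp add: support_graph_def)
  obtain W where u: "u \<in> B" and W: "W \<in> white_components ?H B" and w: "w \<in> W"
    and eq: "{x. x \<notin> B \<and> (u, x) \<in> arcs (with_proj ?H \<restriction> (B \<union> W))} = {w}"
    using force unfolding psd_force_def by blast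
  have W_sub: "W \<subseteq> {0..<n} - B" using white_component_subset[OF W] verts by simp
  have arcs': "(i, j) \<in> arcs (with_proj ?H \<restriction> (B \<union> W))
      \<longleftrightarrow> (i, j) \<in> parcs ?H \<and> i \<in> B \<union> W \<and> j \<in> B \<union> W" for i j
    by (simp add: induce_subgraph_def)
  have uw: "u < n" "w < n" "M $$ (u, w) \<noteq> 0"
    using eq arcs' arcs by blast+
  \<comment> \<open>The restriction \<open>y\<close> of \<open>v\<close> to one white component satisfies \<open>y \<bullet> M y = 0\<close>, so by positive
    semidefiniteness it lies in the kernel itself.\<close>
  define y where "y = vec n (\<lambda>i. if i \<in> W then v $ i else 0)"
  have y: "y \<in> carrier_vec n" by (simp add: y_def)
  have mult: "(M *\<^sub>v z) $ i = (\<Sum>j<n. M $$ (i, j) * z $ j)" if "z \<in> carrier_vec n" "i < n" for z i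
    using Mc that by (auto simp: scalar_prod_def lessThan_atLeast0)
  have My_W: "(M *\<^sub>v y) $ i = 0" if i: "i \<in> W" for i
  proof -
    have "i < n" using i W_sub by auto
    \<comment> \<open>Outside \<open>W\<close> either \<open>v\<close> vanishes (blue vertices) or
      \<open>M\<close> has no entry in row \<open>i\<close> (other white components).\<close>
    have "M $$ (i, j) * y $ j = M $$ (i, j) * v $ j" if j: "j < n" for j
    proof (cases "j \<in> W \<or> v $ j = 0")
      case False
      then have "j \<notin> B" "j \<noteq> i" using B j i by auto
      then have "M $$ (i, j) = 0"
        using white_component_closed[OF H W i, of j] False j \<open>i < n\<close> arcs verts by auto
      then show ?thesis by simp
    qed (use j in \<open>auto simp: y_def\<close>)
    then have "(M *\<^sub>v y) $ i = (M *\<^sub>v v) $ i"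
      unfolding mult[OF y \<open>i < n\<close>] mult[OF v(1) \<open>i < n\<close>] by (intro sum.cong) auto
    then show ?thesis using v(2) \<open>i < n\<close> by simp
  qed
  have "y \<bullet> (M *\<^sub>v y) = (\<Sum>i<n. y $ i * (M *\<^sub>v y) $ i)"
    using Mc by (simp add: scalar_prod_def[of y] lessThan_atLeast0 del: index_mult_mat_vec)
  also have "\<dots> = 0"
  proof (rule sum.neutral, rule ballI)
    fix i assume "i \<in> {..<n}"
    then have "y $ i = 0 \<or> (M *\<^sub>v y) $ i = 0"
      using My_W by (cases "i \<in> W") (auto simp: y_def)
    then show "y $ i * (M *\<^sub>v y) $ i = 0" by auto
  qed
  finally have "y \<bullet> (M *\<^sub>v y) = 0" .
  then have "N *\<^sub>v y = 0\<^sub>v n"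
    using symmetric_mult_kernel[OF N sym y] unfolding M by blast
  then have "M *\<^sub>v y = 0\<^sub>v n"
    unfolding M using assoc_mult_mat_vec[OF N N y] mult_mat_zero_vec[OF N] by simp
  \<comment> \<open>In row \<open>u\<close> only the column \<open>w\<close> survives:
    \<open>y\<close> lives on \<open>W\<close>, which excludes \<open>u\<close> itself, and
    \<open>w\<close> is the only neighbour of \<open>u\<close> there.\<close>
  then have "0 = (M *\<^sub>v y) $ u" using uw by simp
  also have "\<dots> = (\<Sum>j<n. M $$ (u, j) * y $ j)" by (rule mult[OF y uw(1)])
  also have "\<dots> = (\<Sum>j\<in>{w}. M $$ (u, j) * y $ j)"
  proof (rule sum.mono_neutral_right)
    show "\<forall>j\<in>{..<n} - {w}. M $$ (u, j) * y $ j = 0"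
    proof
      fix j assume j: "j \<in> {..<n} - {w}"
      show "M $$ (u, j) * y $ j = 0"
      proof (cases "j \<in> W")
        case True
        then have "j \<notin> B" "j \<noteq> u" using W_sub u by auto
        then have "(u, j) \<notin> parcs ?H" using eq arcs' u True j by blast
        then show ?thesis using arcs uw j \<open>j \<noteq> u\<close> by auto
      qed (use j in \<open>simp add: y_def\<close>)
    qed
  qed (use uw in auto)
  also have "\<dots> = M $$ (u, w) * v $ w" using w uw by (simp add: y_def)
  finally show ?thesis using uw by simp
qed

lemma psd_forcing_set_kernel:
  assumes v: "v \<in> carrier_vec n" "M *\<^sub>v v = 0\<^sub>v n"
    and forcing: "psd_forcing_set (support_graph M) B" and B: "\<forall>b\<in>B. v $ b = 0"
  shows "v = 0\<^sub>v n"
proof -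
  have "(psd_step (support_graph M))\<^sup>*\<^sup>* B (pverts (support_graph M))"
    using forcing by (simp add: psd_forcing_set_def)
  then have "\<forall>b\<in>pverts (support_graph M). b < n \<longrightarrow> v $ b = 0"
  proof (induction rule: rtranclp_induct)
    case (step B1 B2)
    then obtain u w where "psd_force (support_graph M) B1 u w" "B2 = insert w B1"
      unfolding psd_step_def by blast
    then show ?case using psd_force_kernel[OF v step.IH] step.IH by blast
  qed (use B in blast)
  then show ?thesis
    using v(1) square_carrier by (intro eq_vecI) (auto simp: support_graph_def)
qed

text \<open>The columns of \<open>P\<close> indexed by \<open>I\<close> are independent vectors of
  the kernel. Were \<open>B\<close> smaller than \<open>I\<close>, some nontrivial combination would
  vanish on \<open>B\<close>, hence everywhere.\<close>

lemma card_le_psd_forcing_set: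
  assumes P: "P \<in> carrier_mat n n" and Q: "Q \<in> carrier_mat n n" and QP: "Q * P = 1\<^sub>m n"
    and I: "I \<subseteq> {..<n}"
    and ker: "\<And>c. c \<in> carrier_vec n \<Longrightarrow> (\<And>i. i < n \<Longrightarrow> i \<notin> I \<Longrightarrow> c $ i = 0) \<Longrightarrow> M *\<^sub>v (P *\<^sub>v c) = 0\<^sub>v n"
    and forcing: "psd_forcing_set (support_graph M) B"
  shows "card I \<le> card B"
proof (rule ccontr)
  assume "\<not> card I \<le> card B"
  have B: "B \<subseteq> {..<n}"
    using forcing square_carrier by (auto simp: psd_forcing_set_def support_graph_def)
  have "finite B" "finite I" using B I finite_subset by blast+
  moreover have "card B < card I" using \<open>\<not> card I \<le> card B\<close> by simp
  ultimately obtain c where c: "\<exists>i\<in>I. c i \<noteq> 0" "\<forall>i. i \<notin> I \<longrightarrow> c i = 0"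
    "\<forall>b\<in>B. (\<Sum>i\<in>I. P $$ (b, i) * c i) = 0"
    using underdetermined_system[of B I "\<lambda>b i. P $$ (b, i)"] by blast
  have cv: "vec n c \<in> carrier_vec n" by simp
  have Pc: "P *\<^sub>v vec n c \<in> carrier_vec n" using P by simp
  have "\<forall>b\<in>B. (P *\<^sub>v vec n c) $ b = 0"
  proof
    fix b assume b: "b \<in> B"
    then have "(P *\<^sub>v vec n c) $ b = (\<Sum>i<n. P $$ (b, i) * c i)"
      using P B by (auto simp: scalar_prod_def lessThan_atLeast0)
    also have "\<dots> = (\<Sum>i\<in>I. P $$ (b, i) * c i)"
      using I c(2) by (intro sum.mono_neutral_right) auto
    finally show "(P *\<^sub>v vec n c) $ b = 0" using c(3) b by simp
  qed
  moreover have "M *\<^sub>v (P *\<^sub>v vec n c) = 0\<^sub>v n" using c(2) by (intro ker) auto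
  ultimately have "P *\<^sub>v vec n c = 0\<^sub>v n"
    using psd_forcing_set_kernel[OF Pc _ forcing] by blast
  then have "Q *\<^sub>v (P *\<^sub>v vec n c) = 0\<^sub>v n" using mult_mat_zero_vec[OF Q] by simp
  then have "vec n c = 0\<^sub>v n"
    using assoc_mult_mat_vec[OF Q P cv] QP by simp
  then have "c i = 0" if "i < n" for i using that by (metis index_vec index_zero_vec(1))
  then show False using c(1) I by blast
qed

end

section \<open>Bounds for the extrema \<open>Z_plus\<close> and \<open>Z_plus_r\<close>\<close>

lemma finite_psd_forcing_sets:
  "finite (pverts H) \<Longrightarrow> finite {B. psd_forcing_set H B}"
  by (rule finite_subset[of _ "Pow (pverts H)"]) (auto simp: psd_forcing_set_def)

lemma psd_forcing_set_pverts: "psd_forcing_set H (pverts H)"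
  by (simp add: psd_forcing_set_def)

lemma Z_plus_geI:
  assumes "finite (pverts H)" and "\<And>B. psd_forcing_set H B \<Longrightarrow> k \<le> card B"
  shows "k \<le> Z_plus H"
  unfolding Z_plus_def
  using assms finite_psd_forcing_sets psd_forcing_set_pverts by (subst Min_ge_iff) auto

lemma Z_plus_le_card:
  assumes "finite (pverts H)"
  shows "Z_plus H \<le> card (pverts H)"
  unfolding Z_plus_def
  using assms finite_psd_forcing_sets psd_forcing_set_pverts by (intro Min_le) auto

lemma Z_plus_le_Z_plus_r:
  assumes "finite (pverts G)" and "edge_configuration (lazy_walk_multigraph G r) H"
  shows "Z_plus H \<le> Z_plus_r r G"
  unfolding Z_plus_r_def
proof (rule Max_ge)
  \<comment> \<open>The uniform bound shows that \<open>Max\<close> is taken over a finite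
    set.\<close>
  have "Z_plus H' \<le> card (pverts G)" if "edge_configuration (lazy_walk_multigraph G r) H'" for H'
    using that Z_plus_le_card[of H'] assms(1)
    by (simp add: edge_configuration_def lazy_walk_multigraph_def)
  then show "finite {Z_plus H' | H'. edge_configuration (lazy_walk_multigraph G r) H'}"
    by (intro finite_subset[OF _ finite_atMost[of "card (pverts G)"]]) auto
qed (use assms in blast)


section \<open>The multiplicity bound\<close>

lemma support_graph_edge_configuration:
  fixes A :: "real mat"
  assumes verts: "pverts G = {0..<n}" and A: "A \<in> sym_matrices n G" and "\<sigma> \<noteq> 0"
    and M: "M = \<sigma> \<cdot>\<^sub>m shift_prod n A cs" and sym: "transpose_mat M = M"
  shows "edge_configuration (lazy_walk_multigraph G (length cs)) (support_graph M)"
proof -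
  have Ac: "A \<in> carrier_mat n n" using A by (simp add: sym_matrices_def)
  have Sc: "shift_prod n A cs \<in> carrier_mat n n" using Ac by simp
  have Mc: "M \<in> carrier_mat n n" unfolding M using Sc by simp
  have arcs: "(i, j) \<in> parcs (support_graph M) \<longleftrightarrow> shift_prod n A cs $$ (i, j) \<noteq> 0"
    if "i < n" "j < n" "i \<noteq> j" for i j
    using that Mc Sc \<open>\<sigma> \<noteq> 0\<close> by (simp add: support_graph_def) (simp add: M)
  have "(card (\<Union>k\<le>length cs. lazy_walks G k i j) = 1 \<longrightarrow> shift_prod n A cs $$ (i, j) \<noteq> 0) \<and>
      (card (\<Union>k\<le>length cs. lazy_walks G k i j) = 0 \<longrightarrow> shift_prod n A cs $$ (i, j) = 0)"
    if "i < n" "j < n" for i j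
  proof (intro conjI impI)
    assume "card (\<Union>k\<le>length cs. lazy_walks G k i j) = 1"
    then obtain w where "(\<Union>k\<le>length cs. lazy_walks G k i j) = {w}" by (auto simp: card_1_singleton_iff)
    then show "shift_prod n A cs $$ (i, j) \<noteq> 0"
      using shift_prod_unique_lazy_walk[OF verts A] that by blast
  next
    assume "card (\<Union>k\<le>length cs. lazy_walks G k i j) = 0"
    \<comment> \<open>Cardinality 0 means emptiness only for a finite set.\<close>
    moreover have "finite (\<Union>k\<le>length cs. lazy_walks G k i j)"
      using verts by (intro finite_UN_I finite_lazy_walks) auto
    ultimately have "lazy_walks G (length cs) i j = {}" by auto
    then show "shift_prod n A cs $$ (i, j) = 0"
      using shift_prod_no_lazy_walk[OF verts A] that by blast
  qed
  then show ?thesis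
    using pair_graph_support_graph[OF Mc sym] verts Mc arcs
    unfolding edge_configuration_def lazy_walk_multigraph_def
    by (auto simp: support_graph_def)
qed

theorem mainTheorem4:
  fixes n :: nat and G :: "nat pair_pre_digraph" and A :: "real mat" and S :: "real set"
  assumes "pair_graph G" and "pverts G = {0..<n}"
    and "A \<in> sym_matrices n G"
    and "S \<subseteq> spectrum A"
  shows "(\<Sum>\<mu>\<in>S. Polynomial.order \<mu> (char_poly A))
           \<le> Z_plus_r (even_consec_order (spectrum A) S) G"
proof -
  have A: "A \<in> carrier_mat n n" and symA: "transpose_mat A = A"
    using assms(3) by (auto simp: sym_matrices_def)
  have fin: "finite (spectrum A)" by (rule card_finite_spectrum(1)[OF A])
  have finS: "finite S" using finite_subset[OF assms(4) fin] .
  obtain \<sigma> cs where cs: "\<sigma> \<noteq> 0" "length cs = even_consec_order (spectrum A) S" "S \<subseteq> set cs"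
    "\<And>x. x \<in> spectrum A \<Longrightarrow> 0 \<le> \<sigma> * (\<Prod>c\<leftarrow>cs. x - c)"
    using even_consec_order_polynomial[OF fin assms(4)] by blast
  define p where "p = (\<lambda>x. \<sigma> * (\<Prod>c\<leftarrow>cs. x - c))"
  obtain d P Q where w: "similar_mat_wit A (mat_diag n d) P Q"
    and ord: "\<And>\<mu>. Polynomial.order \<mu> (char_poly A) = card {i. i < n \<and> d i = \<mu>}"
    using real_symmetric_diagonalization[OF A symA] by blast
  note PQ = similar_mat_witD2[OF A w]
  \<comment> \<open>\<open>M\<close> is \<open>p(A)\<close> in the form that reads off lazy walks;
    \<open>M_diag\<close> gives its form in the eigenbasis, where the square root \<open>N\<close>
    is visible.\<close>
  define M where "M = \<sigma> \<cdot>\<^sub>m shift_prod n A cs"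
  define N where "N = P * mat_diag n (\<lambda>i. sqrt (p (d i))) * Q"
  have M_diag: "M = P * mat_diag n (\<lambda>i. p (d i)) * Q"
  proof -
    have "mat_diag n (\<lambda>i. p (d i)) = \<sigma> \<cdot>\<^sub>m mat_diag n (\<lambda>i. \<Prod>c\<leftarrow>cs. d i - c)"
      by (intro eq_matI) (auto simp: mat_diag_def p_def)
    then show ?thesis
      unfolding M_def shift_prod_diagonalized[OF A w]
      using mult_smult_distrib[OF PQ(6) mat_diag_dim] mult_smult_assoc_mat[OF mult_carrier_mat[OF PQ(6) mat_diag_dim] PQ(7)]
      by metis
  qed
  \<comment> \<open>The sign of \<open>p\<close> is known only on the spectrum. Each
    \<open>d i\<close> lies there because its multiplicity counts at least the index
    \<open>i\<close>.\<close>
  have p_nonneg: "0 \<le> p (d i)" if "i < n" for i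
  proof -
    have "{j. j < n \<and> d j = d i} \<noteq> {}" "finite {j. j < n \<and> d j = d i}" using that by auto
    then have "Polynomial.order (d i) (char_poly A) \<noteq> 0" unfolding ord by (simp add: card_eq_0_iff)
    then have "poly (char_poly A) (d i) = 0" using order_root by blast
    then have "d i \<in> spectrum A"
      using eigenvalue_root_char_poly[OF A] by (simp add: spectrum_def)
    then show ?thesis unfolding p_def by (rule cs(4))
  qed
  have N: "N \<in> carrier_mat n n"
    unfolding N_def by (rule mult_carrier_mat[OF mult_carrier_mat[OF PQ(6) mat_diag_dim] PQ(7)])
  have symN: "transpose_mat N = N"
    unfolding N_def by (rule spectral_function_symmetric[OF A symA w])
  have "mat_diag n (\<lambda>i. sqrt (p (d i)) * sqrt (p (d i))) = mat_diag n (\<lambda>i. p (d i))"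
    using p_nonneg by (intro eq_matI) (auto simp: mat_diag_def)
  then have MN: "M = N * N"
    unfolding N_def M_diag using similar_mult[OF PQ(6,7) mat_diag_dim mat_diag_dim PQ(2)] by simp
  \<comment> \<open>These indices select the eigenvectors for \<open>S\<close>; \<open>p\<close>
    vanishes at their eigenvalues, so \<open>M\<close> kills their span.\<close>
  define I where "I = {i. i < n \<and> d i \<in> S}"
  have "(\<Sum>\<mu>\<in>S. Polynomial.order \<mu> (char_poly A)) = card (\<Union>\<mu>\<in>S. {i. i < n \<and> d i = \<mu>})"
    unfolding ord using finS by (intro card_UN_disjoint[symmetric]) auto
  also have "(\<Union>\<mu>\<in>S. {i. i < n \<and> d i = \<mu>}) = I" by (auto simp: I_def)
  also have "card I \<le> Z_plus (support_graph M)"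
  proof (rule Z_plus_geI)
    fix B assume forcing: "psd_forcing_set (support_graph M) B"
    show "card I \<le> card B"
    proof (rule card_le_psd_forcing_set[OF N symN MN PQ(6,7,2) _ _ forcing])
      fix c :: "real vec"
      assume c: "c \<in> carrier_vec n" "\<And>i. i < n \<Longrightarrow> i \<notin> I \<Longrightarrow> c $ i = 0"
      have "p (d i) = 0" if "i \<in> I" for i
        using that cs(3) by (auto simp: I_def p_def prod_list_zero_iff)
      then have "p (d i) * c $ i = 0" if "i < n" for i
        using c(2) that by (cases "i \<in> I") auto
      then have "mat_diag n (\<lambda>i. p (d i)) *\<^sub>v c = 0\<^sub>v n"
        using c(1) by (intro eq_vecI) (auto simp: mat_diag_def scalar_prod_def intro!: sum.neutral)
      moreover have "M *\<^sub>v (P *\<^sub>v c) = P *\<^sub>v (mat_diag n (\<lambda>i. p (d i)) *\<^sub>v ((Q * P) *\<^sub>v c))"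
        unfolding M_diag using PQ(6,7) c(1)
        by (simp add: assoc_mult_mat_vec[of _ n n _ n] mult_carrier_mat[of _ n n _ n] mult_mat_vec_carrier[of _ n n])
      ultimately show "M *\<^sub>v (P *\<^sub>v c) = 0\<^sub>v n"
        using PQ(2) c(1) mult_mat_zero_vec[OF PQ(6)] by simp
    qed (auto simp: I_def)
  qed (simp add: support_graph_def)
  also have "\<dots> \<le> Z_plus_r (even_consec_order (spectrum A) S) G"
    using Z_plus_le_Z_plus_r[OF _ support_graph_edge_configuration[OF assms(2,3) cs(1) M_def square_symmetric[OF N symN MN]]]
      cs(2) assms(2) by simp
  finally show ?thesis .
qed

end
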